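(* Let $d\in\mathbb{N}$, let $X=(V,E)$ be a $d$-dimensional crystal lattice over a finite graph $X_0=(V_0,E_0)$ with covering transformation group $\Gamma\cong\mathbb{Z}^d$, and let $\Phi:X\to\Gamma\otimes\mathbb{R}\cong\mathbb{R}^d$ be a non-degenerate periodic realization with $\Phi(x_* )=\mathbf{0}$ for a base point $x_*\in V$. Let $x\in V_0$, $m\in\mathbb{N}$, $\vec a_1,\dots,\vec a_m\in\mathcal{J}(\Phi;x)$, and let $\beta_1,\dots,\beta_m$ be nonnegative real numbers with $\beta_1+\cdots+\beta_m=1$. Let $\mathcal{X}$ be a $V$-valued random variable with $$\mathbf{P}\big(\Phi(\mathcal{X})=\vec a_\ell\big)=\beta_\ell,\qquad \ell=1,2,\dots,m,$$ i.e. the law of $\Phi(\mathcal{X})$ is $\sum_{\ell=1}^m\beta_\ell\delta_{\vec a_\ell}$. Then $\mathcal{X}$ is a multidimensional Shintani zeta random variable on $X$ associated with $x$.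
   Context: Graphs. $X=(V,E)$ is a connected, locally finite graph with set of vertices $V$ and set of oriented edges $E$; $o(e),t(e)$ are the origin and terminus of $e\in E$, and $\bar e$ is its inverse edge. Loops and multiple edges are allowed. A path of length $n$ starting from $y\in V$ is a sequence $(e_1,\dots,e_n)$ of edges with $o(e_1)=y$ and $o(e_{i+1})=t(e_i)$; $\Omega_{y,n}(X)$ is the set of these. Crystal lattice. $X$ is a $d$-dimensional crystal lattice over the finite connected graph $X_0=(V_0,E_0)$ if $X$ is an infinite regular covering graph of $X_0$, with covering map $\pi:X\to X_0$, whose covering transformation group $\Gamma$ is isomorphic to $\mathbb{Z}^d$; $\Gamma$ acts freely on $X$, transitively on each fiber of $\pi$, and $X_0\cong\Gamma\backslash X$. Periodic realization. A piecewise linear map $\Phi:X\to\Gamma\otimes\mathbb{R}\cong\mathbb{R}^d$ (determined by its values on $V$, linear on edges) with $\Phi(\gamma y)=\Phi(y)+\gamma$ for $\gamma\in\Gamma$, $y\in V$, where $\gamma$ is identified with $\gamma\otimes1$. Put $d\Phi(e)=\Phi(t(e))-\Phi(o(e))$. $\Phi$ is non-degenerate if $\Phi|_V$ is injective, $d\Phi(e)\neq\mathbf{0}$ for all $e\in E$, and for every $y\in V$ the map $e\mapsto d\Phi(e)/|d\Phi(e)|$ is injective on $\{e\in E: o(e)=y\}$. Jump set. For $x\in V_0$ with lift $\widetilde x\in\pi^{-1}(x)$, $$\mathcal{J}(\Phi;x)=\Big\{k\vec a\ \Big|\ k\in\mathbb{R},\ \vec a=\sum_{i=1}^n d\Phi(e_i),\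 (e_1,\dots,e_n)\in\Omega_{\widetilde x,n}(X),\ n\in\mathbb{N}\Big\},$$ which does not depend on the choice of lift. Notation. For $\vec c\in\mathbb{R}^d$ and $\vec s=\vec\sigma+\mathrm{i}\vec t\in\mathbb{C}^d$, $\langle\vec c,\vec s\rangle=\langle\vec c,\vec\sigma\rangle+\mathrm{i}\langle\vec c,\vec t\rangle$. Shintani zeta function on $X$ associated with $x\in V_0$. Given $m',r\in\mathbb{N}$; reals $\lambda_{\ell j}\ge0$ such that for each $\ell$ some $\lambda_{\ell j_0}\neq0$; $u_j>0$; $\vec c_\ell\in\mathcal{J}(\Phi;x)$ ($1\le\ell\le m'$, $1\le j\le r$); and $\theta:\mathbb{Z}_{\ge0}^r\to\mathbb{C}$ with $|\theta(n_1,\dots,n_r)|=O((n_1+\cdots+n_r)^\varepsilon)$ as $n_1+\cdots+n_r\to\infty$ for every $\varepsilon>0$, put $$Z_S^{X,\Phi}(x,\vec s)=\sum_{n_1,\dots,n_r=0}^\infty\frac{\theta(n_1,\dots,n_r)}{\prod_{\ell=1}^{m'}\big(\sum_{j=1}^r\lambda_{\ell j}(n_j+u_j)\big)^{\langle\vec c_\ell,\vec s\rangle}}.$$ Shintani zeta random variable. Suppose in addition $\theta$ is real-valued and everywhere $\ge0$ or everywhere $\le0$, and $\vec\sigma\in\mathbb{R}^d\setminus\{\mathbf{0}\}$ is such that the series $Z_S^{X,\Phi}(x,\vec\sigma)$ converges and is nonzero. An $\mathbb{R}^d$-valued random variable $\mathcal{Y}$ is a multidimensional Shintani zeta random variable associated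 with $x$ if, for some such data, its law is the probability measure which puts mass $$\frac{\theta(n_1,\dots,n_r)}{Z_S^{X,\Phi}(x,\vec\sigma)}\prod_{\ell=1}^{m'}\Big(\sum_{j=1}^r\lambda_{\ell j}(n_j+u_j)\Big)^{-\langle\vec c_\ell,\vec\sigma\rangle}$$ at the point $-\sum_{\ell=1}^{m'}\log\big(\sum_{j=1}^r\lambda_{\ell j}(n_j+u_j)\big)\,\vec c_\ell\in\mathbb{R}^d$ for each $(n_1,\dots,n_r)\in\mathbb{Z}_{\ge0}^r$ (masses at coinciding points are added). A $V$-valued random variable $\mathcal{X}$ is a multidimensional Shintani zeta random variable on $X$ associated with $x$ if $\Phi(\mathcal{X})$ is a multidimensional Shintani zeta random variable associated with $x$ (with values in $\Phi(V)$). *)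

theory Defs
  imports
    "HOL-Probability.Probability"
    "HOL-Library.Landau_Symbols"
    "HOL-Algebra.Bij"
    "Graph_Theory.Digraph_Component"
    "Graph_Theory.Bidirected_Digraph"
begin

section \<open>Crystal lattices\<close>

text \<open>
  A graph with oriented edges and edge inversion is a \<open>bidirected_digraph\<close>: origin and
  terminus of an edge are its tail and head, and the inversion has no fixed edge.  (Outside
  the edge set that locale takes the inversion to be the identity.)
\<close>

definition locally_finite :: "('v, 'e) pre_digraph \<Rightarrow> bool" where
  "locally_finite G \<longleftrightarrow> (\<forall>y \<in> verts G. finite (out_arcs G y))"

definition graph_morphism ::
  "('v, 'e) pre_digraph \<Rightarrow> ('e \<Rightarrow> 'e) \<Rightarrow> ('w, 'f) pre_digraph \<Rightarrow> ('f \<Rightarrow> 'f) \<Rightarrow>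
   ('v \<Rightarrow> 'w) \<Rightarrow> ('e \<Rightarrow> 'f) \<Rightarrow> bool" where
  "graph_morphism G barG H barH f g \<longleftrightarrow>
     f \<in> verts G \<rightarrow> verts H \<and> g \<in> arcs G \<rightarrow> arcs H \<and>
     (\<forall>e \<in> arcs G. tail H (g e) = f (tail G e) \<and> head H (g e) = f (head G e) \<and>
                   g (barG e) = barH (g e))"

definition covering_map ::
  "('v, 'e) pre_digraph \<Rightarrow> ('e \<Rightarrow> 'e) \<Rightarrow> ('w, 'f) pre_digraph \<Rightarrow> ('f \<Rightarrow> 'f) \<Rightarrow>
   ('v \<Rightarrow> 'w) \<Rightarrow> ('e \<Rightarrow> 'f) \<Rightarrow> bool" where
  "covering_map X bar X0 bar0 pV pE \<longleftrightarrow>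
     graph_morphism X bar X0 bar0 pV pE \<and>
     pV ` verts X = verts X0 \<and> pE ` arcs X = arcs X0 \<and>
     (\<forall>y \<in> verts X. bij_betw pE (out_arcs X y) (out_arcs X0 (pV y)))"

text \<open>
  The covering transformation group.  A covering transformation is a pair of a vertex and an
  edge bijection, normalised (as in \<open>BijGroup\<close>) to be \<open>undefined\<close> outside the vertex and edge set.
\<close>

definition covering_transformations ::
  "('v, 'e) pre_digraph \<Rightarrow> ('e \<Rightarrow> 'e) \<Rightarrow> ('v \<Rightarrow> 'w) \<Rightarrow> ('e \<Rightarrow> 'f) \<Rightarrow>
   (('v \<Rightarrow> 'v) \<times> ('e \<Rightarrow> 'e)) set" where
  "covering_transformations X bar pV pE =
     {(f, g). f \<in> Bij (verts X) \<and> g \<in> Bij (arcs X) \<and> graph_morphism X bar X bar f g \<and>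
              (\<forall>y \<in> verts X. pV (f y) = pV y) \<and> (\<forall>e \<in> arcs X. pE (g e) = pE e)}"

definition covering_group ::
  "('v, 'e) pre_digraph \<Rightarrow> ('e \<Rightarrow> 'e) \<Rightarrow> ('v \<Rightarrow> 'w) \<Rightarrow> ('e \<Rightarrow> 'f) \<Rightarrow>
   (('v \<Rightarrow> 'v) \<times> ('e \<Rightarrow> 'e)) monoid" where
  "covering_group X bar pV pE =
     (BijGroup (verts X) \<times>\<times> BijGroup (arcs X))
       \<lparr>carrier := covering_transformations X bar pV pE\<rparr>"

definition int_vec_group :: "(int ^ 'd::finite) monoid" where
  "int_vec_group = \<lparr>carrier = UNIV, monoid.mult = (+), one = 0\<rparr>"

text \<open>
  The dimension \<open>d\<close> is the cardinality of the index type \<open>'d\<close>.  The last two conjuncts say that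
  the action is free, and transitive on the vertex and edge fibres (so that \<open>pV\<close> and \<open>pE\<close>
  identify the quotient of \<open>X\<close> by the group with \<open>X0\<close>).
\<close>

definition crystal_lattice ::
  "'d::finite itself \<Rightarrow> ('v, 'e) pre_digraph \<Rightarrow> ('e \<Rightarrow> 'e) \<Rightarrow>
   ('w, 'f) pre_digraph \<Rightarrow> ('f \<Rightarrow> 'f) \<Rightarrow> ('v \<Rightarrow> 'w) \<Rightarrow> ('e \<Rightarrow> 'f) \<Rightarrow> bool" where
  "crystal_lattice (_ :: 'd itself) X bar X0 bar0 pV pE \<longleftrightarrow>
     bidirected_digraph X0 bar0 \<and> fin_digraph X0 \<and> Digraph_Component.connected X0 \<and>
     bidirected_digraph X bar \<and> locally_finite X \<and> Digraph_Component.connected X \<and>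
     infinite (verts X) \<and>
     covering_map X bar X0 bar0 pV pE \<and>
     covering_group X bar pV pE \<cong> (int_vec_group :: (int ^ 'd) monoid) \<and>
     (\<forall>\<gamma> \<in> carrier (covering_group X bar pV pE). \<gamma> \<noteq> \<one>\<^bsub>covering_group X bar pV pE\<^esub> \<longrightarrow>
        (\<forall>y \<in> verts X. fst \<gamma> y \<noteq> y) \<and> (\<forall>e \<in> arcs X. snd \<gamma> e \<noteq> e)) \<and>
     (\<forall>y \<in> verts X. \<forall>z \<in> verts X. pV y = pV z \<longrightarrow>
        (\<exists>\<gamma> \<in> carrier (covering_group X bar pV pE). fst \<gamma> y = z)) \<and>
     (\<forall>e \<in> arcs X. \<forall>e' \<in> arcs X. pE e = pE e' \<longrightarrow>
        (\<exists>\<gamma> \<in> carrier (covering_group X bar pV pE). snd \<gamma> e = e'))"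

section \<open>Periodic realizations\<close>

text \<open>
  An identification of \<open>\<Gamma> \<otimes> \<real>\<close> with \<open>\<real>\<^sup>d\<close> is recorded by the map \<open>\<iota>\<close> giving the image of
  \<open>\<gamma> \<otimes> 1\<close>.  An isomorphism of \<open>\<Gamma>\<close> with the integer lattice identifies \<open>\<Gamma> \<otimes> \<real>\<close> with \<open>\<real>\<^sup>d\<close>; any
  other linear identification differs from this one by a linear automorphism \<open>A\<close> of \<open>\<real>\<^sup>d\<close>.
\<close>

definition real_span_identification ::
  "('g, 'b) monoid_scheme \<Rightarrow> ('g \<Rightarrow> real ^ 'd::finite) \<Rightarrow> bool" where
  "real_span_identification \<Gamma> \<iota> \<longleftrightarrow>
     (\<exists>\<phi> \<in> iso \<Gamma> (int_vec_group :: (int ^ 'd) monoid). \<exists>A :: real ^ 'd \<Rightarrow> real ^ 'd.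
        linear A \<and> bij A \<and>
        (\<forall>\<gamma> \<in> carrier \<Gamma>. \<iota> \<gamma> = A (\<chi> i. real_of_int (\<phi> \<gamma> $ i))))"

text \<open>A piecewise linear map on \<open>X\<close> is given by its values on the vertices.\<close>

definition periodic_realization ::
  "('v, 'e) pre_digraph \<Rightarrow> ('e \<Rightarrow> 'e) \<Rightarrow> ('v \<Rightarrow> 'w) \<Rightarrow> ('e \<Rightarrow> 'f) \<Rightarrow>
   (('v \<Rightarrow> 'v) \<times> ('e \<Rightarrow> 'e) \<Rightarrow> real ^ 'd::finite) \<Rightarrow> ('v \<Rightarrow> real ^ 'd) \<Rightarrow> bool" where
  "periodic_realization X bar pV pE \<iota> \<Phi> \<longleftrightarrow>
     real_span_identification (covering_group X bar pV pE) \<iota> \<and>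
     (\<forall>\<gamma> \<in> carrier (covering_group X bar pV pE). \<forall>y \<in> verts X. \<Phi> (fst \<gamma> y) = \<Phi> y + \<iota> \<gamma>)"

definition edge_diff :: "('v, 'e) pre_digraph \<Rightarrow> ('v \<Rightarrow> real ^ 'd::finite) \<Rightarrow> 'e \<Rightarrow> real ^ 'd" where
  "edge_diff X \<Phi> e = \<Phi> (head X e) - \<Phi> (tail X e)"

definition nondegenerate :: "('v, 'e) pre_digraph \<Rightarrow> ('v \<Rightarrow> real ^ 'd::finite) \<Rightarrow> bool" where
  "nondegenerate X \<Phi> \<longleftrightarrow>
     inj_on \<Phi> (verts X) \<and> (\<forall>e \<in> arcs X. edge_diff X \<Phi> e \<noteq> 0) \<and>
     (\<forall>y \<in> verts X. inj_on (\<lambda>e. edge_diff X \<Phi> e /\<^sub>R norm (edge_diff X \<Phi> e)) (out_arcs X y))"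

text \<open>
  All lifts \<open>y\<close> of \<open>x\<close> give the same set of vectors when \<open>\<Phi>\<close> is periodic, so we may let \<open>y\<close>
  range over the whole fibre.
\<close>

definition jump_set ::
  "('v, 'e) pre_digraph \<Rightarrow> ('v \<Rightarrow> 'w) \<Rightarrow> ('v \<Rightarrow> real ^ 'd::finite) \<Rightarrow> 'w \<Rightarrow> (real ^ 'd) set" where
  "jump_set X pV \<Phi> x =
     {k *\<^sub>R (\<Sum>e\<leftarrow>p. edge_diff X \<Phi> e) | k y p z.
        y \<in> verts X \<and> pV y = x \<and> pre_digraph.awalk X y p z \<and> 1 \<le> length p}"

section \<open>Shintani zeta functions\<close>

text \<open>
  Indices \<open>\<ell>\<close> and \<open>j\<close> are counted from \<open>0\<close>; a multi-index is an element \<open>n\<close> of \<open>multi_idx r\<close>.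
\<close>

definition multi_idx :: "nat \<Rightarrow> (nat \<Rightarrow> nat) set" where
  "multi_idx r = {..<r} \<rightarrow>\<^sub>E UNIV"

definition lin_form ::
  "nat \<Rightarrow> (nat \<Rightarrow> nat \<Rightarrow> real) \<Rightarrow> (nat \<Rightarrow> real) \<Rightarrow> nat \<Rightarrow> (nat \<Rightarrow> nat) \<Rightarrow> real" where
  "lin_form r lam u l n = (\<Sum>j<r. lam l j * (real (n j) + u j))"

definition pairing :: "real ^ 'd::finite \<Rightarrow> complex ^ 'd \<Rightarrow> complex" where
  "pairing c s = complex_of_real (c \<bullet> (\<chi> i. Re (s $ i))) + \<i> * complex_of_real (c \<bullet> (\<chi> i. Im (s $ i)))"

definition shintani_data ::
  "(real ^ 'd::finite) set \<Rightarrow> nat \<Rightarrow> nat \<Rightarrow> (nat \<Rightarrow> nat \<Rightarrow> real) \<Rightarrow> (nat \<Rightarrow> real) \<Rightarrow>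
   (nat \<Rightarrow> real ^ 'd) \<Rightarrow> ((nat \<Rightarrow> nat) \<Rightarrow> complex) \<Rightarrow> bool" where
  "shintani_data J m r lam u c \<theta> \<longleftrightarrow>
     1 \<le> m \<and> 1 \<le> r \<and>
     (\<forall>l<m. (\<forall>j<r. 0 \<le> lam l j) \<and> (\<exists>j<r. lam l j \<noteq> 0)) \<and>
     (\<forall>j<r. 0 < u j) \<and>
     (\<forall>l<m. c l \<in> J) \<and>
     (\<forall>\<epsilon>>0. \<theta> \<in> O[inf (filtercomap (\<lambda>n. \<Sum>j<r. n j) at_top) (principal (multi_idx r))](
           \<lambda>n. complex_of_real (real (\<Sum>j<r. n j) powr \<epsilon>)))"

definition shintani_term ::
  "nat \<Rightarrow> nat \<Rightarrow> (nat \<Rightarrow> nat \<Rightarrow> real) \<Rightarrow> (nat \<Rightarrow> real) \<Rightarrow> (nat \<Rightarrow> real ^ 'd::finite) \<Rightarrow>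
   ((nat \<Rightarrow> nat) \<Rightarrow> complex) \<Rightarrow> complex ^ 'd \<Rightarrow> (nat \<Rightarrow> nat) \<Rightarrow> complex" where
  "shintani_term m r lam u c \<theta> s n =
     \<theta> n / (\<Prod>l<m. complex_of_real (lin_form r lam u l n) powr pairing (c l) s)"

definition shintani_zeta ::
  "nat \<Rightarrow> nat \<Rightarrow> (nat \<Rightarrow> nat \<Rightarrow> real) \<Rightarrow> (nat \<Rightarrow> real) \<Rightarrow> (nat \<Rightarrow> real ^ 'd::finite) \<Rightarrow>
   ((nat \<Rightarrow> nat) \<Rightarrow> complex) \<Rightarrow> complex ^ 'd \<Rightarrow> complex" where
  "shintani_zeta m r lam u c \<theta> s = (\<Sum>\<^sub>\<infinity>n\<in>multi_idx r. shintani_term m r lam u c \<theta> s n)"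

section \<open>Shintani zeta random variables\<close>

definition complex_vec :: "real ^ 'd::finite \<Rightarrow> complex ^ 'd" where
  "complex_vec \<sigma> = (\<chi> i. complex_of_real (\<sigma> $ i))"

text \<open>
  At a real argument the zeta value of a real \<open>\<theta>\<close> is real, so \<open>Re\<close> below is only a type
  conversion.
\<close>

definition shintani_mass ::
  "nat \<Rightarrow> nat \<Rightarrow> (nat \<Rightarrow> nat \<Rightarrow> real) \<Rightarrow> (nat \<Rightarrow> real) \<Rightarrow> (nat \<Rightarrow> real ^ 'd::finite) \<Rightarrow>
   ((nat \<Rightarrow> nat) \<Rightarrow> real) \<Rightarrow> real ^ 'd \<Rightarrow> (nat \<Rightarrow> nat) \<Rightarrow> real" where
  "shintani_mass m r lam u c \<theta> \<sigma> n =
     \<theta> n / Re (shintani_zeta m r lam u c (\<lambda>n. complex_of_real (\<theta> n)) (complex_vec \<sigma>)) *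
     (\<Prod>l<m. lin_form r lam u l n powr (- (c l \<bullet> \<sigma>)))"

definition shintani_point ::
  "nat \<Rightarrow> nat \<Rightarrow> (nat \<Rightarrow> nat \<Rightarrow> real) \<Rightarrow> (nat \<Rightarrow> real) \<Rightarrow> (nat \<Rightarrow> real ^ 'd::finite) \<Rightarrow>
   (nat \<Rightarrow> nat) \<Rightarrow> real ^ 'd" where
  "shintani_point m r lam u c n = - (\<Sum>l<m. ln (lin_form r lam u l n) *\<^sub>R c l)"

text \<open>
  The law is the image under \<open>shintani_point\<close> of the measure with the given masses on the set
  of multi-indices; taking the image adds up masses at coinciding points.
\<close>

definition shintani_law ::
  "nat \<Rightarrow> nat \<Rightarrow> (nat \<Rightarrow> nat \<Rightarrow> real) \<Rightarrow> (nat \<Rightarrow> real) \<Rightarrow> (nat \<Rightarrow> real ^ 'd::finite) \<Rightarrow>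
   ((nat \<Rightarrow> nat) \<Rightarrow> real) \<Rightarrow> real ^ 'd \<Rightarrow> (real ^ 'd) measure" where
  "shintani_law m r lam u c \<theta> \<sigma> =
     distr (density (count_space (multi_idx r)) (\<lambda>n. ennreal (shintani_mass m r lam u c \<theta> \<sigma> n)))
       borel (shintani_point m r lam u c)"

text \<open>
  The terms of the series at \<open>\<sigma>\<close> all have the same sign, so its convergence as a multiple series
  is unconditional summability.
\<close>

definition shintani_rv ::
  "(real ^ 'd::finite) set \<Rightarrow> 'a measure \<Rightarrow> ('a \<Rightarrow> real ^ 'd) \<Rightarrow> bool" where
  "shintani_rv J M Y \<longleftrightarrow>
     Y \<in> borel_measurable M \<and>
     (\<exists>m r lam u c (\<theta> :: (nat \<Rightarrow> nat) \<Rightarrow> real) \<sigma>.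
        shintani_data J m r lam u c (\<lambda>n. complex_of_real (\<theta> n)) \<and>
        ((\<forall>n \<in> multi_idx r. 0 \<le> \<theta> n) \<or> (\<forall>n \<in> multi_idx r. \<theta> n \<le> 0)) \<and>
        \<sigma> \<noteq> 0 \<and>
        shintani_term m r lam u c (\<lambda>n. complex_of_real (\<theta> n)) (complex_vec \<sigma>) summable_on multi_idx r \<and>
        shintani_zeta m r lam u c (\<lambda>n. complex_of_real (\<theta> n)) (complex_vec \<sigma>) \<noteq> 0 \<and>
        distr M borel Y = shintani_law m r lam u c \<theta> \<sigma>)"

definition shintani_rv_on ::
  "('v, 'e) pre_digraph \<Rightarrow> ('v \<Rightarrow> 'w) \<Rightarrow> ('v \<Rightarrow> real ^ 'd::finite) \<Rightarrow> 'w \<Rightarrow>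
   'a measure \<Rightarrow> ('a \<Rightarrow> 'v) \<Rightarrow> bool" where
  "shintani_rv_on X pV \<Phi> x M \<X> \<longleftrightarrow>
     \<X> \<in> M \<rightarrow>\<^sub>M count_space (verts X) \<and>
     shintani_rv (jump_set X pV \<Phi> x) M (\<lambda>\<omega>. \<Phi> (\<X> \<omega>))"

end

theory Submission
  imports Defs
begin

text \<open>
  Any finitely supported law is obtained from finitely many terms of a Shintani series.  Take as
  many indices as there are atoms, all \<open>u\<^sub>j = 1\<close> and \<open>\<lambda>\<close> the identity matrix: at the
  \<open>k\<close>-th unit multi-index the \<open>l\<close>-th linear form is \<open>2\<close> if \<open>l = k\<close> and \<open>1\<close> otherwise, so for
  \<open>c\<^sub>l = - a\<^sub>l / ln 2\<close> the corresponding point is \<open>a\<^sub>k\<close>.  Let \<open>\<theta>\<close> be supported on the unit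
  multi-indices, with values chosen so that the terms of the series are the \<open>\<beta>\<^sub>k\<close>.
  The vectors \<open>c\<^sub>l\<close> are admissible because jump sets are closed under scaling.
\<close>

text \<open>The restriction to \<open>{..<r}\<close> provides the \<open>undefined\<close> values
  outside the index range that \<open>multi_idx r\<close> demands.\<close>

definition unit_idx :: "nat \<Rightarrow> nat \<Rightarrow> nat \<Rightarrow> nat" where
  "unit_idx r k = (\<lambda>j\<in>{..<r}. if j = k then 1 else 0)"

lemma unit_idx_in_multi_idx [simp]: "unit_idx r k \<in> multi_idx r"
  by (simp add: unit_idx_def multi_idx_def)

lemma inj_on_unit_idx: "inj_on (unit_idx r) {..<r}"
proof (rule inj_onI)
  fix k k' assume "k \<in> {..<r}" "k' \<in> {..<r}" "unit_idx r k = unit_idx r k'"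
  then have "unit_idx r k k = unit_idx r k' k" "k < r" by simp_all
  then show "k = k'" by (simp add: unit_idx_def split: if_splits)
qed

lemma scaleR_in_jump_set:
  assumes "v \<in> jump_set X pV \<Phi> x"
  shows "c *\<^sub>R v \<in> jump_set X pV \<Phi> x"
proof -
  obtain k y p z where v: "v = k *\<^sub>R (\<Sum>e\<leftarrow>p. edge_diff X \<Phi> e)"
    and p: "y \<in> verts X \<and> pV y = x \<and> pre_digraph.awalk X y p z \<and> 1 \<le> length p"
    using assms unfolding jump_set_def by blast
  have "c *\<^sub>R v = (c * k) *\<^sub>R (\<Sum>e\<leftarrow>p. edge_diff X \<Phi> e)" by (simp add: v)
  with p show ?thesis unfolding jump_set_def by blast
qed

lemma pairing_complex_vec: "pairing c (complex_vec \<sigma>) = complex_of_real (c \<bullet> \<sigma>)"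
  by (simp add: pairing_def complex_vec_def inner_vec_def)

text \<open>Complex and real powers agree on nonnegative bases, so at a real argument a term of the
  series becomes the real product that occurs in \<open>shintani_mass\<close>.\<close>

lemma shintani_term_complex_vec:
  assumes "\<And>l. l < m \<Longrightarrow> 0 \<le> lin_form r lam u l n"
  shows "shintani_term m r lam u c (\<lambda>n. complex_of_real (\<theta> n)) (complex_vec \<sigma>) n =
    complex_of_real (\<theta> n * (\<Prod>l<m. lin_form r lam u l n powr (- (c l \<bullet> \<sigma>))))"
proof -
  have "(\<Prod>l<m. complex_of_real (lin_form r lam u l n) powr pairing (c l) (complex_vec \<sigma>)) =
      complex_of_real (\<Prod>l<m. lin_form r lam u l n powr (c l \<bullet> \<sigma>))"
    using assms by (simp add: pairing_complex_vec powr_of_real)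
  then show ?thesis
    by (simp add: shintani_term_def powr_minus prod_inversef[symmetric] o_def divide_inverse)
qed

text \<open>A finite set of multi-indices has bounded total degree, so \<open>\<theta>\<close>
  eventually vanishes along the degree filter and is dominated by any \<open>g\<close>, with
  constant 0.\<close>

lemma finite_support_bigo_total_degree:
  fixes \<theta> :: "(nat \<Rightarrow> nat) \<Rightarrow> complex"
  assumes "finite K" and "\<And>n. n \<notin> K \<Longrightarrow> \<theta> n = 0"
  shows "\<theta> \<in> O[inf (filtercomap (\<lambda>n. \<Sum>j<r. n j) at_top) F](g)"
proof -
  \<comment> \<open>The sum over \<open>K\<close> bounds each single degree in \<open>K\<close>;
    \<open>Suc\<close> makes the bound strict.\<close>
  define N where "N = Suc (\<Sum>n\<in>K. \<Sum>j<r. n j)"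
  have "\<theta> n = 0" if "(\<Sum>j<r. n j) \<ge> N" for n
  proof (rule assms(2), rule notI)
    assume "n \<in> K"
    then have "(\<Sum>j<r. n j) \<le> (\<Sum>n\<in>K. \<Sum>j<r. n j)"
      using assms(1) by (intro member_le_sum) auto
    with that show False by (simp add: N_def)
  qed
  then have "eventually (\<lambda>n. \<theta> n = 0) (filtercomap (\<lambda>n. \<Sum>j<r. n j) at_top)"
    unfolding eventually_filtercomap using eventually_ge_at_top[of N] by blast
  then have "eventually (\<lambda>n. \<theta> n = 0) (inf (filtercomap (\<lambda>n. \<Sum>j<r. n j) at_top) F)"
    by (rule filter_leD[OF inf_le1])
  then show ?thesis
    by (intro bigoI[where c = 0]) (auto elim: eventually_mono)
qed

text \<open>Each mass carries the factor \<open>\<theta> n\<close>, so the integral against the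
  counting measure collapses to \<open>K\<close>. Summing over indices rather than points handles
  coinciding points automatically.\<close>

lemma emeasure_shintani_law_finite_support:
  assumes "finite K" "K \<subseteq> multi_idx r" "\<And>n. n \<notin> K \<Longrightarrow> \<theta> n = 0" "B \<in> sets borel"
  shows "emeasure (shintani_law m r lam u c \<theta> \<sigma>) B =
    (\<Sum>n\<in>K. ennreal (shintani_mass m r lam u c \<theta> \<sigma> n) * indicator B (shintani_point m r lam u c n))"
proof -
  let ?mass = "shintani_mass m r lam u c \<theta> \<sigma>" and ?pt = "shintani_point m r lam u c"
  have "emeasure (shintani_law m r lam u c \<theta> \<sigma>) B =
      (\<integral>\<^sup>+n. ennreal (?mass n) * indicator (?pt -` B \<inter> multi_idx r) n \<partial>count_space (multi_idx r))"
    using assms(4) by (simp add: shintani_law_def emeasure_distr emeasure_density)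
  also have "\<dots> = (\<Sum>n\<in>K. ennreal (?mass n) * indicator (?pt -` B \<inter> multi_idx r) n)"
    using assms(1-3) by (intro nn_integral_count_space') (auto simp: shintani_mass_def)
  also have "\<dots> = (\<Sum>n\<in>K. ennreal (?mass n) * indicator B (?pt n))"
    using assms(2) by (intro sum.cong) (auto simp: indicator_def)
  finally show ?thesis .
qed

text \<open>The graph-free core of the argument: closure of \<open>J\<close> under scaling makes the
  vectors \<open>c l\<close> admissible. Repeated atoms and zero weights are allowed, because the
  laws are compared on Borel sets.\<close>

lemma shintani_rv_finite_law:
  fixes a :: "nat \<Rightarrow> real ^ 'd::finite"
  assumes J: "\<And>v k. v \<in> J \<Longrightarrow> k *\<^sub>R v \<in> J"
    and m: "1 \<le> m" and aJ: "\<And>l. l < m \<Longrightarrow> a l \<in> J"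
    and \<beta>: "\<And>l. l < m \<Longrightarrow> 0 \<le> \<beta> l" "(\<Sum>l<m. \<beta> l) = 1"
    and Y: "Y \<in> borel_measurable M"
    and law: "\<And>B. B \<in> sets borel \<Longrightarrow>
      emeasure (distr M borel Y) B = (\<Sum>l<m. ennreal (\<beta> l) * indicator B (a l))"
  shows "shintani_rv J M Y"
proof -
  define lam :: "nat \<Rightarrow> nat \<Rightarrow> real" where "lam l j = (if l = j then 1 else 0)" for l j
  define u :: "nat \<Rightarrow> real" where "u j = 1" for j
  define c where "c l = (- 1 / ln 2) *\<^sub>R a l" for l
  \<comment> \<open>The all-ones vector; any nonzero vector would do, as \<open>\<theta>\<close>
    compensates for it.\<close>
  define \<sigma> :: "real ^ 'd" where "\<sigma> = 1"
  define e where "e = unit_idx m"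
  define K where "K = e ` {..<m}"
  \<comment> \<open>The power of 2 cancels the denominator of the term at \<open>e k\<close>. Since
    \<open>e\<close> is injective on \<open>{..<m}\<close>, at most one summand is nonzero.\<close>
  define \<theta> where "\<theta> n = (\<Sum>k<m. if n = e k then \<beta> k * 2 powr (c k \<bullet> \<sigma>) else 0)" for n
  have cJ: "c l \<in> J" if "l < m" for l unfolding c_def by (intro J aJ that)
  let ?t = "shintani_term m m lam u c (\<lambda>n. complex_of_real (\<theta> n)) (complex_vec \<sigma>)"
  let ?z = "shintani_zeta m m lam u c (\<lambda>n. complex_of_real (\<theta> n)) (complex_vec \<sigma>)"
  have inj: "inj_on e {..<m}" unfolding e_def by (rule inj_on_unit_idx)
  have K: "finite K" "K \<subseteq> multi_idx m" by (auto simp: K_def e_def)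
  have \<theta>0: "\<theta> n = 0" if "n \<notin> K" for n
    using that by (auto simp: \<theta>_def K_def intro!: sum.neutral)
  have \<theta>e: "\<theta> (e k) = \<beta> k * 2 powr (c k \<bullet> \<sigma>)" if "k < m" for k
  proof -
    have "\<theta> (e k) = (\<Sum>k'<m. if k = k' then \<beta> k' * 2 powr (c k' \<bullet> \<sigma>) else 0)"
      unfolding \<theta>_def using that inj by (intro sum.cong) (auto dest: inj_onD)
    with that show ?thesis by simp
  qed
  have lin: "lin_form m lam u l n = real (n l) + 1" if "l < m" for l n
  proof -
    have "lin_form m lam u l n = (\<Sum>j<m. if l = j then real (n j) + 1 else 0)"
      unfolding lin_form_def lam_def u_def by (intro sum.cong) auto
    with that show ?thesis by simp
  qed
  \<comment> \<open>Forms with value 1 contribute powers equal to 1 and logarithms equal to 0, so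
    only the factor or summand with \<open>l = k\<close> survives below.\<close>
  have lin_e: "lin_form m lam u l (e k) = (if l = k then 2 else 1)" if "l < m" for l k
    using that by (simp add: lin e_def unit_idx_def)
  have term_e: "\<theta> (e k) * (\<Prod>l<m. lin_form m lam u l (e k) powr (- (c l \<bullet> \<sigma>))) = \<beta> k"
    if "k < m" for k
  proof -
    have "(\<Prod>l<m. lin_form m lam u l (e k) powr (- (c l \<bullet> \<sigma>))) =
        (\<Prod>l<m. if l = k then 2 powr (- (c l \<bullet> \<sigma>)) else 1)"
      by (intro prod.cong) (auto simp: lin_e)
    also have "\<dots> = 2 powr (- (c k \<bullet> \<sigma>))" using that by simp
    finally show ?thesis using that by (simp add: \<theta>e powr_minus)
  qed
  have t_e: "?t (e k) = complex_of_real (\<beta> k)" if "k < m" for k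
  proof -
    have "?t (e k) =
        complex_of_real (\<theta> (e k) * (\<Prod>l<m. lin_form m lam u l (e k) powr (- (c l \<bullet> \<sigma>))))"
      by (rule shintani_term_complex_vec) (simp add: lin_e)
    then show ?thesis by (simp only: term_e[OF that])
  qed
  have "(?t has_sum (\<Sum>n\<in>K. ?t n)) (multi_idx m)"
    using K by (intro has_sum_finite_neutralI) (auto simp: shintani_term_def \<theta>0)
  \<comment> \<open>The value 1 yields convergence and nonvanishing of the zeta value at once, and
    removes the normalising denominator from the masses.\<close>
  moreover have "(\<Sum>n\<in>K. ?t n) = 1"
  proof -
    have "(\<Sum>n\<in>K. ?t n) = (\<Sum>k<m. complex_of_real (\<beta> k))"
      unfolding K_def using inj by (simp add: sum.reindex t_e)
    also have "\<dots> = 1" using \<beta>(2) by (simp flip: of_real_sum)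
    finally show ?thesis .
  qed
  ultimately have sums: "(?t has_sum 1) (multi_idx m)" by simp
  then have zeta: "?z = 1" unfolding shintani_zeta_def by (rule infsumI)
  have point_e: "shintani_point m m lam u c (e k) = a k" if "k < m" for k
  proof -
    have "shintani_point m m lam u c (e k) = - (\<Sum>l<m. if l = k then ln 2 *\<^sub>R c l else 0)"
      unfolding shintani_point_def
      by (intro arg_cong[where f = uminus] sum.cong) (auto simp: lin_e)
    also have "\<dots> = a k" using that by (simp add: c_def)
    finally show ?thesis .
  qed
  have mass_e: "shintani_mass m m lam u c \<theta> \<sigma> (e k) = \<beta> k" if "k < m" for k
    using term_e[OF that] by (simp add: shintani_mass_def zeta)
  have "distr M borel Y = shintani_law m m lam u c \<theta> \<sigma>"
  proof (rule measure_eqI)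
    fix B assume "B \<in> sets (distr M borel Y)"
    then have B: "B \<in> sets borel" by simp
    have "emeasure (shintani_law m m lam u c \<theta> \<sigma>) B =
        (\<Sum>n\<in>K. ennreal (shintani_mass m m lam u c \<theta> \<sigma> n) *
          indicator B (shintani_point m m lam u c n))"
      using K \<theta>0 B by (rule emeasure_shintani_law_finite_support)
    also have "\<dots> = (\<Sum>l<m. ennreal (\<beta> l) * indicator B (a l))"
      unfolding K_def sum.reindex[OF inj] by (intro sum.cong) (simp_all add: mass_e point_e)
    finally show "emeasure (distr M borel Y) B = emeasure (shintani_law m m lam u c \<theta> \<sigma>) B"
      by (simp add: law[OF B])
  qed (simp add: shintani_law_def)
  moreover have "shintani_data J m m lam u c (\<lambda>n. complex_of_real (\<theta> n))"
    unfolding shintani_data_def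
    using m cJ K(1) \<theta>0
    by (auto simp: lam_def u_def simp del: of_real_sum
        intro!: finite_support_bigo_total_degree[of K])
  moreover have "\<forall>n\<in>multi_idx m. 0 \<le> \<theta> n"
    using \<beta>(1) by (auto simp: \<theta>_def intro!: sum_nonneg)
  moreover have "\<sigma> \<noteq> 0" by (simp add: \<sigma>_def)
  ultimately show ?thesis
    unfolding shintani_rv_def using Y zeta sums
    by (metis has_sum_imp_summable zero_neq_one)
qed

theorem theorem3p5:
  fixes X :: "('v, 'e) pre_digraph" and bar :: "'e \<Rightarrow> 'e"
    and X0 :: "('w, 'f) pre_digraph" and bar0 :: "'f \<Rightarrow> 'f"
    and pV :: "'v \<Rightarrow> 'w" and pE :: "'e \<Rightarrow> 'f"
    and \<iota> :: "('v \<Rightarrow> 'v) \<times> ('e \<Rightarrow> 'e) \<Rightarrow> real ^ 'd::finite"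
    and \<Phi> :: "'v \<Rightarrow> real ^ 'd"
    and xstar :: 'v and x :: 'w and m :: nat
    and a :: "nat \<Rightarrow> real ^ 'd" and \<beta> :: "nat \<Rightarrow> real"
    and M :: "'a measure" and \<X> :: "'a \<Rightarrow> 'v"
  assumes "crystal_lattice TYPE('d) X bar X0 bar0 pV pE"
    and "periodic_realization X bar pV pE \<iota> \<Phi>"
    and "nondegenerate X \<Phi>"
    and "xstar \<in> verts X" and "\<Phi> xstar = 0"
    and "x \<in> verts X0"
    and "1 \<le> m"
    and "\<forall>l<m. a l \<in> jump_set X pV \<Phi> x"
    and "\<forall>l<m. 0 \<le> \<beta> l" and "(\<Sum>l<m. \<beta> l) = 1"
    and "prob_space M"
    and "\<X> \<in> M \<rightarrow>\<^sub>M count_space (verts X)"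
    and "\<forall>B \<in> sets borel. measure M {\<omega> \<in> space M. \<Phi> (\<X> \<omega>) \<in> B} = (\<Sum>l<m. \<beta> l * indicator B (a l))"
  shows "shintani_rv_on X pV \<Phi> x M \<X>"
proof -
  interpret prob_space M by fact
  have Y: "(\<lambda>\<omega>. \<Phi> (\<X> \<omega>)) \<in> borel_measurable M"
    using assms(12) by (rule measurable_compose) simp
  have "shintani_rv (jump_set X pV \<Phi> x) M (\<lambda>\<omega>. \<Phi> (\<X> \<omega>))"
  \<comment> \<open>The hypothesis on the law concerns real-valued probabilities. It passes to
    \<open>emeasure\<close> because \<open>M\<close> is finite, and \<open>ennreal\<close>
    distributes over the sum because the weights are nonnegative.\<close>
  proof (rule shintani_rv_finite_law[OF scaleR_in_jump_set assms(7) _ _ assms(10) Y])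
    fix B :: "(real ^ 'd) set" assume B: "B \<in> sets borel"
    have "emeasure (distr M borel (\<lambda>\<omega>. \<Phi> (\<X> \<omega>))) B =
        emeasure M {\<omega> \<in> space M. \<Phi> (\<X> \<omega>) \<in> B}"
      using Y B by (simp add: emeasure_distr vimage_def Int_def conj_commute)
    also have "\<dots> = ennreal (\<Sum>l<m. \<beta> l * indicator B (a l))"
      using assms(13) B by (simp add: emeasure_eq_measure)
    also have "\<dots> = (\<Sum>l<m. ennreal (\<beta> l * indicator B (a l)))"
      using assms(9) by (intro sum_ennreal[symmetric]) auto
    also have "\<dots> = (\<Sum>l<m. ennreal (\<beta> l) * indicator B (a l))"
      by (intro sum.cong) (auto simp: indicator_def)
    finally show "emeasure (distr M borel (\<lambda>\<omega>. \<Phi> (\<X> \<omega>))) B =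
        (\<Sum>l<m. ennreal (\<beta> l) * indicator B (a l))" .
  qed (use assms(8,9) in auto)
  with assms(12) show ?thesis by (simp add: shintani_rv_on_def)
qed

end
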